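(* Let $X$ be a nonzero Banach space over $\mathbb{R}$ or $\mathbb{C}$. For all $1\leq p<\infty$ and $k\in\mathbb{N}$, \[\frac{n(X)}{k^{1/p}}\leq n_{(p,k)}(X)\leq n(X).\]
   Context: $L(X)$ is the space of bounded linear operators on $X$ with the operator norm. $S_X$ denotes the unit sphere of $X$, $X^*$ the dual space, and $\Pi_X=\{(x,x^* )\in S_X\times S_{X^*}: x^*(x)=1\}$. For $T\in L(X)$, the numerical radius is $w(T)=\sup\{|x^*(Tx)|:(x,x^* )\in\Pi_X\}$, and the numerical index of $X$ is $n(X)=\inf\{w(T):T\in L(X),\|T\|=1\}$. For $1\leq p<\infty$, $k\in\mathbb{N}$ and $\mathcal{T}=(T_1,\ldots,T_k)\in L(X)^k$, put $\|\mathcal{T}\|_p=\sup\{(\sum_{i=1}^k\|T_ix\|^p)^{1/p}:x\in S_X\}$ and $w_p(\mathcal{T})=\sup\{(\sum_{i=1}^k|x^*(T_ix)|^p)^{1/p}:(x,x^* )\in\Pi_X\}$. The $(p,k)$-th joint numerical index of $X$ is $n_{(p,k)}(X)=\inf\{w_p(\mathcal{T}):\mathcal{T}\in L(X)^k,\ \|\mathcal{T}\|_p=1\}$. *)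

theory Defs
  imports "HOL-Analysis.Analysis"
begin

(* A normed space over the scalar field 'k (below always the reals or the complex numbers).
   The type class of 'a carries the norm and the underlying real vector space; "smul" is the
   multiplication by scalars from 'k, which has to extend the real one. *)
locale normed_space_over = vector_space smul
  for smul :: "'k::real_normed_field \<Rightarrow> 'a::real_normed_vector \<Rightarrow> 'a" +
  assumes smul_of_real: "smul (of_real r) x = r *\<^sub>R x"
    and norm_smul: "norm (smul c x) = norm c * norm x"

(* Elements of the type of bounded linear functions are only real-linear, so linearity over 'k
   is imposed separately. The norm of that type is the operator norm; it does not depend on
   the scalar field. *)
definition bounded_operators ::
    "('k::real_normed_field \<Rightarrow> 'a::real_normed_vector \<Rightarrow> 'a) \<Rightarrow> ('a \<Rightarrow>\<^sub>L 'a) set" where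
  "bounded_operators smul = {T. Vector_Spaces.linear smul smul (blinfun_apply T)}"

definition dual_space ::
    "('k::real_normed_field \<Rightarrow> 'a::real_normed_vector \<Rightarrow> 'a) \<Rightarrow> ('a \<Rightarrow>\<^sub>L 'k) set" where
  "dual_space smul = {f. Vector_Spaces.linear smul (*) (blinfun_apply f)}"

definition state_pairs ::
    "('k::real_normed_field \<Rightarrow> 'a::real_normed_vector \<Rightarrow> 'a) \<Rightarrow> ('a \<times> ('a \<Rightarrow>\<^sub>L 'k)) set" where
  "state_pairs smul =
     {(x, f). x \<in> sphere 0 1 \<and> f \<in> dual_space smul \<inter> sphere 0 1 \<and> blinfun_apply f x = 1}"

(* The suprema and infima below are taken in the reals. If 'a is a nonzero space, they range over
   nonempty sets that are bounded on the required side; state_pairs is nonempty by the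
   Hahn-Banach theorem. *)
definition numerical_radius ::
    "('k::real_normed_field \<Rightarrow> 'a::real_normed_vector \<Rightarrow> 'a) \<Rightarrow> ('a \<Rightarrow>\<^sub>L 'a) \<Rightarrow> real" where
  "numerical_radius smul T =
     (SUP (x, f) \<in> state_pairs smul. norm (blinfun_apply f (blinfun_apply T x)))"

definition numerical_index ::
    "('k::real_normed_field \<Rightarrow> 'a::real_normed_vector \<Rightarrow> 'a) \<Rightarrow> real" where
  "numerical_index smul =
     (INF T \<in> {T \<in> bounded_operators smul. norm T = 1}. numerical_radius smul T)"

definition joint_norm ::
    "real \<Rightarrow> nat \<Rightarrow> (nat \<Rightarrow> 'a::real_normed_vector \<Rightarrow>\<^sub>L 'a) \<Rightarrow> real" where
  "joint_norm p k T =
     (SUP x \<in> sphere 0 1. (\<Sum>i=1..k. norm (blinfun_apply (T i) x) powr p) powr (1 / p))"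

definition joint_numerical_radius ::
    "('k::real_normed_field \<Rightarrow> 'a::real_normed_vector \<Rightarrow> 'a) \<Rightarrow> real \<Rightarrow> nat \<Rightarrow>
      (nat \<Rightarrow> 'a \<Rightarrow>\<^sub>L 'a) \<Rightarrow> real" where
  "joint_numerical_radius smul p k T =
     (SUP (x, f) \<in> state_pairs smul.
        (\<Sum>i=1..k. norm (blinfun_apply f (blinfun_apply (T i) x)) powr p) powr (1 / p))"

definition joint_numerical_index ::
    "('k::real_normed_field \<Rightarrow> 'a::real_normed_vector \<Rightarrow> 'a) \<Rightarrow> real \<Rightarrow> nat \<Rightarrow> real" where
  "joint_numerical_index smul p k =
     (INF T \<in> {T \<in> {1..k} \<rightarrow>\<^sub>E bounded_operators smul. joint_norm p k T = 1}.
        joint_numerical_radius smul p k T)"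

end

theory Submission
  imports Defs
begin

text \<open>
  For the lower bound, let \<open>W\<close> be the joint numerical radius of \<open>T\<close>. Each operator satisfies
  \<open>n(X) * norm (T i) \<le> w(T i) \<le> W\<close>; taking \<open>p\<close>-norms over \<open>i\<close> gives
  \<open>n(X) * joint_norm p k T \<le> k powr (1/p) * W\<close>. For the upper bound, the tuple \<open>(T, 0, \<dots>, 0)\<close> has
  the norm and the numerical radius of \<open>T\<close>. The suprema are meaningful only because state pairs
  exist, which is the Hahn-Banach theorem: a minimal sublinear functional is linear.
\<close>

section \<open>Norming functionals\<close>

definition sublinear :: "('a::real_vector \<Rightarrow> real) \<Rightarrow> bool" where
  "sublinear q \<longleftrightarrow>
     (\<forall>x y. q (x + y) \<le> q x + q y) \<and> (\<forall>s x. 0 \<le> s \<longrightarrow> q (s *\<^sub>R x) \<le> s * q x)"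

lemma sublinearI:
  assumes "\<And>x y. q (x + y) \<le> q x + q y" "\<And>s x. 0 \<le> s \<Longrightarrow> q (s *\<^sub>R x) \<le> s * q x"
  shows "sublinear q"
  using assms by (auto simp: sublinear_def)

lemma sublinear_add: "sublinear q \<Longrightarrow> q (x + y) \<le> q x + q y"
  and sublinear_scaleR: "sublinear q \<Longrightarrow> 0 \<le> s \<Longrightarrow> q (s *\<^sub>R x) \<le> s * q x"
  by (auto simp: sublinear_def)

lemma sublinear_zero: "sublinear q \<Longrightarrow> q 0 = 0"
  using sublinear_add[of q 0 0] sublinear_scaleR[of q 0 0] by simp

lemma sublinear_minus: "sublinear q \<Longrightarrow> - q (- x) \<le> q x"
  using sublinear_add[of q x "- x"] sublinear_zero[of q] by simp

text \<open>The largest sublinear \<open>r \<le> q\<close> with \<open>r (- y) = - q y\<close>; if \<open>q\<close> is minimal it equals \<open>q\<close>, which is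
  then additive in the direction \<open>y\<close>.\<close>
definition reduce :: "('a::real_vector \<Rightarrow> real) \<Rightarrow> 'a \<Rightarrow> 'a \<Rightarrow> real" where
  "reduce q y x = (INF t\<in>{0..}. q (x + t *\<^sub>R y) - t * q y)"

text \<open>The infimum is finite: \<open>t * q y\<close> equals \<open>q (t *\<^sub>R y)\<close>,
  and subadditivity then bounds every term below by \<open>- q (- x)\<close>.\<close>

lemma reduce_le:
  assumes "sublinear q" "0 \<le> t"
  shows "reduce q y x \<le> q (x + t *\<^sub>R y) - t * q y"
proof -
  have "- q (- x) \<le> q (x + t *\<^sub>R y) - t * q y" if "0 \<le> t" for t
  proof -
    have "t * q y = q (t *\<^sub>R y)"
    proof (cases "t = 0")
      case False
      \<comment> \<open>Scaling back by \<open>inverse t\<close> turns the assumed inequality for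
        positive scalars into an equality.\<close>
      with that have "q (inverse t *\<^sub>R (t *\<^sub>R y)) \<le> inverse t * q (t *\<^sub>R y)"
        by (intro sublinear_scaleR[OF assms(1)]) auto
      with False that have "t * q y \<le> q (t *\<^sub>R y)"
        by (simp add: field_simps)
      with sublinear_scaleR[OF assms(1) that, of y] show ?thesis by simp
    qed (simp add: sublinear_zero[OF assms(1)])
    with sublinear_add[OF assms(1), of "x + t *\<^sub>R y" "- x"] show ?thesis
      by simp
  qed
  then have "bdd_below ((\<lambda>t. q (x + t *\<^sub>R y) - t * q y) ` {0..})"
    by (intro bdd_belowI2) auto
  then show ?thesis
    unfolding reduce_def using assms(2) by (intro cINF_lower) auto
qed

lemma reduce_greatest:
  assumes "\<And>t. 0 \<le> t \<Longrightarrow> c \<le> q (x + t *\<^sub>R y) - t * q y"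
  shows "c \<le> reduce q y x"
  unfolding reduce_def using assms by (intro cINF_greatest) auto

text \<open>The expression under the infimum is sublinear jointly in the vector and
  \<open>t\<close>: parameters for two vectors add up, and the parameter is rescaled along with the
  vector.\<close>

lemma sublinear_reduce:
  assumes "sublinear q"
  shows "sublinear (reduce q y)"
proof (rule sublinearI)
  fix u v
  have "reduce q y (u + v) \<le> (q (u + s *\<^sub>R y) - s * q y) + (q (v + t *\<^sub>R y) - t * q y)"
    if "0 \<le> s" "0 \<le> t" for s t
    using reduce_le[OF assms, of "s + t" y "u + v"] that
      sublinear_add[OF assms, of "u + s *\<^sub>R y" "v + t *\<^sub>R y"]
    by (simp add: algebra_simps)
  \<comment> \<open>One parameter at a time: the infimum over \<open>s\<close> with \<open>t\<close>
    fixed, then the infimum over \<open>t\<close>.\<close>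
  then have "reduce q y (u + v) - (q (v + t *\<^sub>R y) - t * q y) \<le> reduce q y u" if "0 \<le> t" for t
    using that by (intro reduce_greatest) (smt (verit))
  then have "reduce q y (u + v) - reduce q y u \<le> reduce q y v"
    by (intro reduce_greatest) (smt (verit))
  then show "reduce q y (u + v) \<le> reduce q y u + reduce q y v" by simp
next
  fix s :: real and u
  assume s: "0 \<le> s"
  show "reduce q y (s *\<^sub>R u) \<le> s * reduce q y u"
  proof (cases "s = 0")
    case True
    with reduce_le[OF assms, of 0 y 0] sublinear_zero[OF assms] show ?thesis by simp
  next
    case False
    have "reduce q y (s *\<^sub>R u) / s \<le> q (u + t *\<^sub>R y) - t * q y" if "0 \<le> t" for t
    proof -
      have "reduce q y (s *\<^sub>R u) \<le> q (s *\<^sub>R (u + t *\<^sub>R y)) - s * t * q y"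
        using reduce_le[OF assms, of "s * t" y "s *\<^sub>R u"] s that by (simp add: algebra_simps)
      also have "\<dots> \<le> s * (q (u + t *\<^sub>R y) - t * q y)"
        using sublinear_scaleR[OF assms s, of "u + t *\<^sub>R y"] by (simp add: algebra_simps)
      finally show ?thesis using s False by (simp add: field_simps)
    qed
    then have "reduce q y (s *\<^sub>R u) / s \<le> reduce q y u"
      by (rule reduce_greatest)
    with s False show ?thesis by (simp add: field_simps)
  qed
qed

text \<open>Subadditivity rests on comparability: the smaller of \<open>q\<close> and
  \<open>r\<close>, used at both \<open>x\<close> and \<open>y\<close>, bounds the infimum at
  \<open>x + y\<close> by \<open>q x + r y\<close>.\<close>

lemma sublinear_INF_chain:
  assumes "C \<noteq> {}" and sub: "\<And>q. q \<in> C \<Longrightarrow> sublinear q"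
    and bdd: "\<And>x. bdd_below ((\<lambda>q. q x) ` C)"
    and chain: "\<And>q r. q \<in> C \<Longrightarrow> r \<in> C \<Longrightarrow> q \<le> r \<or> r \<le> q"
  shows "sublinear (\<lambda>x. INF q\<in>C. q x)"
proof (rule sublinearI)
  fix x y :: 'a
  let ?u = "\<lambda>x. INF q\<in>C. q x"
  have low: "?u x \<le> q x" if "q \<in> C" for q x
    using that bdd by (intro cINF_lower)
  have le: "?u (x + y) \<le> q x + r y" if "q \<in> C" "r \<in> C" for q r
    using chain[OF that]
  proof
    assume "q \<le> r"
    then show ?thesis
      using low[OF that(1), of "x + y"] sublinear_add[OF sub[OF that(1)], of x y] le_funD[of q r y]
      by linarith
  next
    assume "r \<le> q"
    then show ?thesis
      using low[OF that(2), of "x + y"] sublinear_add[OF sub[OF that(2)], of x y] le_funD[of r q x]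
      by linarith
  qed
  have "?u (x + y) - r y \<le> ?u x" if "r \<in> C" for r
    by (rule cINF_greatest[OF assms(1)]) (use le[OF _ that] in \<open>simp add: algebra_simps\<close>)
  then have "?u (x + y) - ?u x \<le> ?u y"
    by (intro cINF_greatest[OF assms(1)]) (simp add: algebra_simps)
  then show "?u (x + y) \<le> ?u x + ?u y" by simp
next
  fix s :: real and x :: 'a
  let ?u = "\<lambda>x. INF q\<in>C. q x"
  assume s: "0 \<le> s"
  have le: "?u (s *\<^sub>R x) \<le> s * q x" if "q \<in> C" for q
  proof -
    have "?u (s *\<^sub>R x) \<le> q (s *\<^sub>R x)"
      using that bdd by (intro cINF_lower)
    with sublinear_scaleR[OF sub[OF that] s, of x] show ?thesis by linarith
  qed
  show "?u (s *\<^sub>R x) \<le> s * ?u x"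
  proof (cases "s = 0")
    case True
    obtain q where "q \<in> C" using assms(1) by blast
    with le[of q] True show ?thesis by simp
  next
    case False
    have "?u (s *\<^sub>R x) / s \<le> ?u x"
      by (rule cINF_greatest[OF assms(1)]) (use le s False in \<open>simp add: field_simps\<close>)
    with s False show ?thesis by (simp add: field_simps)
  qed
qed

text \<open>Zorn's lemma for the reversed pointwise order, with pointwise infima as bounds of
  nonempty chains.\<close>

lemma exists_minimal_sublinear:
  assumes "sublinear p"
  obtains q where "sublinear q" "q \<le> p" "\<And>r. sublinear r \<Longrightarrow> r \<le> q \<Longrightarrow> r = q"
proof -
  let ?A = "{q. sublinear q \<and> q \<le> p}"
  have "\<exists>m\<in>?A. \<forall>a\<in>?A. a \<le> m \<longrightarrow> a = m"
  proof (rule predicate_Zorn[where P = "\<lambda>a b. b \<le> a"])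
    show "partial_order_on ?A (relation_of (\<lambda>a b. b \<le> a) ?A)"
      by (rule partial_order_on_relation_ofI) auto
  next
    fix C assume "C \<in> Chains (relation_of (\<lambda>a b. b \<le> a) ?A)"
    then have chain: "\<And>q r. q \<in> C \<Longrightarrow> r \<in> C \<Longrightarrow> q \<le> r \<or> r \<le> q"
      and sub: "\<And>q. q \<in> C \<Longrightarrow> sublinear q" and below: "\<And>q. q \<in> C \<Longrightarrow> q \<le> p"
      by (auto simp: Chains_def relation_of_def)
    show "\<exists>u\<in>?A. \<forall>a\<in>C. u \<le> a"
    proof (cases "C = {}")
      case True
      with assms show ?thesis by auto
    next
      case False
      \<comment> \<open>A lower bound independent of \<open>q\<close>, so the pointwise infimum over
        the chain is a genuine real infimum.\<close>
      have "- p (- x) \<le> q x" if "q \<in> C" for q x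
        using sublinear_minus[OF sub[OF that], of x] le_funD[OF below[OF that], of "- x"] by linarith
      then have bdd: "bdd_below ((\<lambda>q. q x) ` C)" for x
        by (intro bdd_belowI2)
      let ?u = "\<lambda>x. INF q\<in>C. q x"
      have low: "?u \<le> q" if "q \<in> C" for q
        using that bdd by (intro le_funI cINF_lower)
      from False obtain q where "q \<in> C" by blast
      with low below have "?u \<le> p" by (meson order_trans)
      with low sublinear_INF_chain[OF False sub bdd chain] show ?thesis by blast
    qed
  qed
  then obtain m where m: "sublinear m" "m \<le> p" and
      min: "\<And>a. sublinear a \<Longrightarrow> a \<le> p \<Longrightarrow> a \<le> m \<Longrightarrow> a = m"
    by blast
  show thesis
    by (rule that[OF m]) (use min m(2) in \<open>meson order_trans\<close>)
qed

text \<open>Minimality gives \<open>reduce q y = q\<close>, whose parameter \<open>t = 1\<close>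
  yields superadditivity. Additivity makes \<open>q\<close> odd, which carries homogeneity over to
  negative scalars.\<close>

lemma linear_minimal_sublinear:
  assumes q: "sublinear q" and min: "\<And>r. sublinear r \<Longrightarrow> r \<le> q \<Longrightarrow> r = q"
  shows "linear q"
proof -
  have "reduce q y \<le> q" for y
    using reduce_le[OF q, of 0 y] by (auto simp: le_fun_def)
  then have red: "reduce q y = q" for y
    by (intro min sublinear_reduce q)
  have add: "q (x + y) = q x + q y" for x y
    using reduce_le[OF q, of 1 y x] sublinear_add[OF q, of x y] by (simp add: red)
  have neg: "q (- x) = - q x" for x
    using add[of x "- x"] sublinear_zero[OF q] by simp
  have pos: "q (s *\<^sub>R x) = s * q x" if "0 \<le> s" for s x
    using sublinear_scaleR[OF q that, of x] sublinear_scaleR[OF q that, of "- x"] by (simp add: neg)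
  have "q (s *\<^sub>R x) = s * q x" for s x
    using pos[of s x] pos[of "- s" x] neg[of "s *\<^sub>R x"] by (cases "0 \<le> s") auto
  with add show ?thesis
    by (intro linearI) auto
qed

text \<open>Starting Zorn below \<open>reduce p a\<close> instead of \<open>p\<close> forces
  \<open>q (- a) \<le> - p a\<close>, so the linear minimal element attains \<open>p\<close> at
  \<open>a\<close>.\<close>

lemma Hahn_Banach_sublinear:
  assumes "sublinear p"
  obtains f where "linear f" "\<And>x. f x \<le> p x" "f a = p a"
proof -
  obtain q where q: "sublinear q" "q \<le> reduce p a" "\<And>r. sublinear r \<Longrightarrow> r \<le> q \<Longrightarrow> r = q"
    using exists_minimal_sublinear[OF sublinear_reduce[OF assms, of a]] by blast
  have lin: "linear q"
    using q by (intro linear_minimal_sublinear)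
  have le: "q x \<le> p x" for x
    using le_funD[OF q(2), of x] reduce_le[OF assms, of 0 a x] by simp
  have "q (- a) \<le> - p a"
    using le_funD[OF q(2), of "- a"] reduce_le[OF assms, of 1 a "- a"] sublinear_zero[OF assms] by simp
  then have "q a = p a"
    using le[of a] linear_neg[OF lin, of a] by simp
  with lin le that show thesis by blast
qed

lemma exists_norming_functional:
  fixes a :: "'a::real_normed_vector"
  obtains f :: "'a \<Rightarrow> real" where "linear f" "\<And>x. \<bar>f x\<bar> \<le> norm x" "f a = norm a"
proof -
  have "sublinear (norm :: 'a \<Rightarrow> real)"
    by (rule sublinearI) (auto intro: norm_triangle_ineq)
  then obtain f :: "'a \<Rightarrow> real" where f: "linear f" "\<And>x. f x \<le> norm x" "f a = norm a"
    using Hahn_Banach_sublinear[of norm a] by blast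
  have "\<bar>f x\<bar> \<le> norm x" for x
    using f(2)[of x] f(2)[of "- x"] linear_neg[OF f(1), of x] by simp
  with f that show thesis by blast
qed

section \<open>Existence of state pairs over the reals and the complex numbers\<close>

lemma normed_space_over_scaleR:
  "normed_space_over (scaleR :: real \<Rightarrow> 'a::real_normed_vector \<Rightarrow> 'a)"
  by unfold_locales auto

context normed_space_over
begin

lemma vector_space_smul: "vector_space smul" ..

lemma linear_smulI:
  assumes "\<And>x y. f (x + y) = f x + f y" "\<And>c x. f (smul c x) = smul c (f x)"
  shows "Vector_Spaces.linear smul smul f"
  using assms by (auto simp: Vector_Spaces.linear_def module_hom_def module_hom_axioms_def
      vector_space_smul module_axioms)

text \<open>A contraction has operator norm at most one, and the value at the unit vector
  \<open>a\<close> attains it; so such an \<open>f\<close> lies on the dual sphere.\<close>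

lemma state_pairsI:
  assumes add: "\<And>x y. f (x + y) = f x + f y" and scale: "\<And>c x. f (smul c x) = c * f x"
    and le: "\<And>x. norm (f x) \<le> norm x" and a: "norm a = 1" "f a = 1"
  shows "(a, Blinfun f) \<in> state_pairs smul"
proof -
  have "bounded_linear f"
  proof (rule bounded_linear_intro[where K = 1])
    show "f (r *\<^sub>R x) = r *\<^sub>R f x" for r x
      using scale[of "of_real r" x] by (simp add: smul_of_real scaleR_conv_of_real)
  qed (use add le in auto)
  then have app: "blinfun_apply (Blinfun f) = f"
    by (rule bounded_linear_Blinfun_apply)
  have "norm (Blinfun f) \<le> 1"
    by (rule norm_blinfun_bound) (auto simp: app le)
  moreover have "1 \<le> norm (Blinfun f)"
    using norm_blinfun[of "Blinfun f" a] a by (simp add: app)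
  ultimately have "norm (Blinfun f) = 1" by simp
  moreover have "Vector_Spaces.linear smul (*) f"
  proof -
    have "vector_space ((*) :: 'k \<Rightarrow> 'k \<Rightarrow> 'k)"
      by unfold_locales (auto simp: algebra_simps)
    then show ?thesis
      using add scale by (auto simp: Vector_Spaces.linear_def module_hom_def module_hom_axioms_def
          vector_space_smul module_iff_vector_space)
  qed
  ultimately show ?thesis
    using a by (simp add: state_pairs_def dual_space_def app)
qed

end

lemma exists_norm_one:
  fixes x :: "'a::real_normed_vector"
  assumes "x \<noteq> 0"
  obtains a :: 'a where "norm a = 1"
  using assms that[of "sgn x"] by (simp add: norm_sgn)

lemma state_pairs_scaleR_nonempty:
  assumes "\<exists>x::'a::real_normed_vector. x \<noteq> 0"
  shows "state_pairs (scaleR :: real \<Rightarrow> 'a \<Rightarrow> 'a) \<noteq> {}"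
proof -
  interpret normed_space_over "scaleR :: real \<Rightarrow> 'a \<Rightarrow> 'a"
    by (rule normed_space_over_scaleR)
  obtain a :: 'a where a: "norm a = 1"
    using assms exists_norm_one by blast
  obtain f :: "'a \<Rightarrow> real" where f: "linear f" "\<And>x. \<bar>f x\<bar> \<le> norm x" "f a = norm a"
    using exists_norming_functional[of a] by blast
  have "(a, Blinfun f) \<in> state_pairs scaleR"
    using f a by (intro state_pairsI) (auto simp: linear_add linear_scale)
  then show ?thesis by blast
qed

text \<open>Bohnenblust-Sobczyk: a real norming functional is the real part of a complex-linear one,
  and a rotation of the argument shows that the norm does not grow.\<close>

lemma state_pairs_complex_nonempty:
  fixes smul :: "complex \<Rightarrow> 'a::real_normed_vector \<Rightarrow> 'a"
  assumes "normed_space_over smul" "\<exists>x::'a. x \<noteq> 0"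
  shows "state_pairs smul \<noteq> {}"
proof -
  interpret normed_space_over smul by fact
  obtain a :: 'a where a: "norm a = 1"
    using assms exists_norm_one by blast
  obtain g :: "'a \<Rightarrow> real" where g: "linear g" "\<And>x. \<bar>g x\<bar> \<le> norm x" "g a = norm a"
    using exists_norming_functional[of a] by blast
  \<comment> \<open>the complex-linear functional with real part \<open>g\<close>\<close>
  define f where "f x = Complex (g x) (- g (smul \<i> x))" for x
  have add: "f (x + y) = f x + f y" for x y
    by (simp add: f_def complex_eq_iff linear_add[OF g(1)] scale_right_distrib)
  have smul_eq: "smul c x = Re c *\<^sub>R x + Im c *\<^sub>R smul \<i> x" for c x
  proof -
    have "smul c x = smul (of_real (Re c) + of_real (Im c) * \<i>) x"
      by (simp add: complex_eq_iff)
    also have "\<dots> = Re c *\<^sub>R x + Im c *\<^sub>R smul \<i> x"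
      by (simp only: scale_left_distrib smul_of_real flip: scale_scale)
    finally show ?thesis .
  qed
  have scale: "f (smul c x) = c * f x" for c x
  proof -
    have Re: "g (smul c x) = Re c * g x + Im c * g (smul \<i> x)" for c
      by (subst smul_eq) (simp add: linear_add[OF g(1)] linear_scale[OF g(1)])
    \<comment> \<open>This is \<open>Re\<close> with \<open>\<i> * c\<close> in place of
      \<open>c\<close>.\<close>
    have Im: "g (smul \<i> (smul c x)) = Re (\<i> * c) * g x + Im (\<i> * c) * g (smul \<i> x)"
      by (subst scale_scale) (rule Re)
    show ?thesis
      unfolding f_def Re[of c] Im by (simp add: complex_eq_iff algebra_simps)
  qed
  have le: "norm (f x) \<le> norm x" for x
  proof -
    \<comment> \<open>Multiplying by \<open>?c\<close>, of modulus one or (if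
      \<open>f x = 0\<close>) zero, makes the value of \<open>f\<close> real and nonnegative, hence
      equal to a value of \<open>g\<close>.\<close>
    let ?c = "cnj (sgn (f x))"
    have "?c * f x = of_real (norm (f x))"
    proof (cases "f x = 0")
      case False
      have "?c * f x = f x * cnj (f x) / of_real (norm (f x))"
        by (simp add: sgn_eq mult.commute)
      also have "\<dots> = of_real (norm (f x))"
        using False unfolding complex_norm_square[symmetric] by (simp add: power2_eq_square)
      finally show ?thesis .
    qed simp
    then have "norm (f x) = Re (f (smul ?c x))"
      by (simp add: scale)
    also have "\<dots> \<le> norm (smul ?c x)"
      using g(2)[of "smul ?c x"] by (simp add: f_def)
    also have "\<dots> \<le> norm x"
      by (simp add: norm_smul norm_sgn)
    finally show ?thesis .
  qed
  have "f a = 1"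
  proof -
    have "Re (f a) = 1" using g(3) a by (simp add: f_def)
    \<comment> \<open>With real part one and modulus at most one, no imaginary part is left.\<close>
    moreover have "(Re (f a))\<^sup>2 + (Im (f a))\<^sup>2 \<le> 1"
      using le[of a] a by (simp add: cmod_def)
    ultimately show ?thesis by (simp add: complex_eq_iff)
  qed
  then have "(a, Blinfun f) \<in> state_pairs smul"
    using add scale le a by (intro state_pairsI)
  then show ?thesis by blast
qed

section \<open>Finite p-norms\<close>

text \<open>Written to match the expressions under the suprema of \<open>joint_norm\<close> and
  \<open>joint_numerical_radius\<close> after unfolding.\<close>

definition lp_norm :: "real \<Rightarrow> nat \<Rightarrow> (nat \<Rightarrow> real) \<Rightarrow> real" where
  "lp_norm p k a = (\<Sum>i=1..k. a i powr p) powr (1 / p)"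

lemma lp_norm_nonneg: "0 \<le> lp_norm p k a"
  by (simp add: lp_norm_def)

lemma lp_norm_mono:
  assumes "0 < p" "\<And>i. i \<in> {1..k} \<Longrightarrow> 0 \<le> a i" "\<And>i. i \<in> {1..k} \<Longrightarrow> a i \<le> b i"
  shows "lp_norm p k a \<le> lp_norm p k b"
  unfolding lp_norm_def using assms by (intro powr_mono2 sum_mono sum_nonneg) auto

lemma component_le_lp_norm:
  assumes "0 < p" "i \<in> {1..k}" "0 \<le> a i"
  shows "a i \<le> lp_norm p k a"
proof -
  have "a i = (a i powr p) powr (1 / p)"
    using assms by (simp add: powr_powr)
  also have "\<dots> \<le> lp_norm p k a"
    unfolding lp_norm_def using assms by (intro powr_mono2 member_le_sum) auto
  finally show ?thesis .
qed

lemma lp_norm_scale: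
  assumes "0 < p" "0 \<le> c" "\<And>i. i \<in> {1..k} \<Longrightarrow> 0 \<le> a i"
  shows "lp_norm p k (\<lambda>i. c * a i) = c * lp_norm p k a"
proof -
  have "(\<Sum>i=1..k. (c * a i) powr p) = c powr p * (\<Sum>i=1..k. a i powr p)"
    using assms by (auto simp: sum_distrib_left powr_mult intro!: sum.cong)
  then show ?thesis
    using assms by (simp add: lp_norm_def powr_mult powr_powr sum_nonneg)
qed

text \<open>The source of the factor \<open>real k powr (1 / p)\<close> in the lower bound.\<close>

lemma lp_norm_const:
  assumes "0 < p" "0 \<le> c"
  shows "lp_norm p k (\<lambda>i. c) = real k powr (1 / p) * c"
  using assms by (simp add: lp_norm_def powr_mult powr_powr)

lemma lp_norm_single:
  assumes "0 < p" "1 \<le> k" "0 \<le> a 1" "\<And>i. i \<in> {2..k} \<Longrightarrow> a i = 0"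
  shows "lp_norm p k a = a 1"
proof -
  \<comment> \<open>Vanishing entries drop out because \<open>0 powr p = 0\<close>.\<close>
  have "(\<Sum>i=1..k. a i powr p) = (\<Sum>i\<in>{1}. a i powr p)"
    using assms by (intro sum.mono_neutral_right) auto
  with assms show ?thesis by (simp add: lp_norm_def powr_powr)
qed

section \<open>Numerical radii\<close>

text \<open>The identity witnesses that the infima over operators of norm one range over nonempty
  sets.\<close>

lemma norm_id_blinfun:
  assumes "\<exists>x::'a::real_normed_vector. x \<noteq> 0"
  shows "norm (id_blinfun :: 'a \<Rightarrow>\<^sub>L 'a) = 1"
proof -
  obtain a :: 'a where "norm a = 1"
    using assms exists_norm_one by blast
  then show ?thesis
    using norm_blinfun[of "id_blinfun :: 'a \<Rightarrow>\<^sub>L 'a" a] norm_blinfun_id_le[where 'a = 'a] by simp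
qed

text \<open>Homogeneity reduces a nonzero \<open>x\<close> to the unit vector \<open>sgn x\<close>;
  this ties the operator norm to the sphere used in \<open>joint_norm\<close>.\<close>

lemma SUP_norm_sphere:
  fixes T :: "'a::real_normed_vector \<Rightarrow>\<^sub>L 'b::real_normed_vector"
  assumes "\<exists>x::'a. x \<noteq> 0"
  shows "(SUP x\<in>sphere 0 1. norm (blinfun_apply T x)) = norm T"
proof (rule antisym)
  let ?S = "SUP x\<in>sphere 0 1. norm (blinfun_apply T x)"
  obtain a :: 'a where a: "norm a = 1"
    using assms exists_norm_one by blast
  have le: "norm (blinfun_apply T x) \<le> norm T" if "x \<in> sphere 0 1" for x
    using norm_blinfun[of T x] that by simp
  show "?S \<le> norm T"
    using a le by (intro cSUP_least) auto
  have up: "norm (blinfun_apply T x) \<le> ?S" if "x \<in> sphere 0 1" for x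
    using that le by (intro cSUP_upper bdd_aboveI2)
  have "0 \<le> ?S"
    using up[of a] a by (simp add: order_trans[OF norm_ge_zero])
  then show "norm T \<le> ?S"
  proof (rule norm_blinfun_bound)
    fix x
    show "norm (blinfun_apply T x) \<le> ?S * norm x"
    proof (cases "x = 0")
      case False
      then have "norm (blinfun_apply T (sgn x)) \<le> ?S"
        by (intro up) (simp add: norm_sgn)
      with False show ?thesis
        by (simp add: sgn_div_norm blinfun.scaleR_right field_simps)
    qed simp
  qed
qed

text \<open>In general only an inequality, since the operators may attain or approach their norms at
  different unit vectors.\<close>

lemma joint_norm_le:
  assumes "0 < p" "\<exists>x::'a::real_normed_vector. x \<noteq> 0"
  shows "joint_norm p k (T :: nat \<Rightarrow> 'a \<Rightarrow>\<^sub>L 'a) \<le> lp_norm p k (\<lambda>i. norm (T i))"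
proof -
  obtain a :: 'a where a: "norm a = 1"
    using assms exists_norm_one by blast
  have "lp_norm p k (\<lambda>i. norm (blinfun_apply (T i) x)) \<le> lp_norm p k (\<lambda>i. norm (T i))"
    if "norm x = 1" for x
  proof (rule lp_norm_mono[OF assms(1)])
    show "norm (blinfun_apply (T i) x) \<le> norm (T i)" for i
      using norm_blinfun[of "T i" x] that by simp
  qed simp
  then show ?thesis
    unfolding joint_norm_def using a by (intro cSUP_least) (auto simp: lp_norm_def)
qed

text \<open>Bounds the sets under the suprema, so that these are true real suprema.\<close>

lemma state_pairs_norm_le:
  assumes "(x, f) \<in> state_pairs smul"
  shows "norm (blinfun_apply f (blinfun_apply T x)) \<le> norm T"
proof -
  have "norm x = 1" "norm f = 1"
    using assms by (auto simp: state_pairs_def)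
  then show ?thesis
    using norm_blinfun[of f "blinfun_apply T x"] norm_blinfun[of T x] by simp
qed

lemma numerical_radius_upper:
  assumes "(x, f) \<in> state_pairs smul"
  shows "norm (blinfun_apply f (blinfun_apply T x)) \<le> numerical_radius smul T"
proof -
  have "bdd_above ((\<lambda>(x, f). norm (blinfun_apply f (blinfun_apply T x))) ` state_pairs smul)"
    by (rule bdd_aboveI2[where M = "norm T"]) (auto intro: state_pairs_norm_le)
  from cSUP_upper[OF assms this] show ?thesis
    by (simp add: numerical_radius_def)
qed

lemma numerical_radius_least:
  assumes "state_pairs smul \<noteq> {}"
    and "\<And>x f. (x, f) \<in> state_pairs smul \<Longrightarrow> norm (blinfun_apply f (blinfun_apply T x)) \<le> c"
  shows "numerical_radius smul T \<le> c"
  unfolding numerical_radius_def using assms by (intro cSUP_least) auto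

lemma numerical_radius_nonneg:
  assumes "state_pairs smul \<noteq> {}"
  shows "0 \<le> numerical_radius smul T"
proof -
  obtain x f where "(x, f) \<in> state_pairs smul"
    using assms by (metis ex_in_conv surj_pair)
  from numerical_radius_upper[OF this, of T] show ?thesis
    using norm_ge_zero order_trans by blast
qed

text \<open>The half of homogeneity that normalises an operator in
  \<open>numerical_index_le\<close>.\<close>

lemma numerical_radius_scaleR_le:
  assumes "state_pairs smul \<noteq> {}"
  shows "numerical_radius smul (r *\<^sub>R T) \<le> \<bar>r\<bar> * numerical_radius smul T"
  using assms numerical_radius_upper[of _ _ smul T]
  by (intro numerical_radius_least) (auto simp: blinfun.scaleR_left blinfun.scaleR_right
      intro!: mult_left_mono)

section \<open>The joint numerical radius and its relation to single operators\<close>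

lemma joint_numerical_radius_upper:
  assumes "0 < p" "(x, f) \<in> state_pairs smul"
  shows "lp_norm p k (\<lambda>i. norm (blinfun_apply f (blinfun_apply (T i) x)))
    \<le> joint_numerical_radius smul p k T"
proof -
  have "lp_norm p k (\<lambda>i. norm (blinfun_apply f (blinfun_apply (T i) x)))
      \<le> lp_norm p k (\<lambda>i. norm (T i))" if "(x, f) \<in> state_pairs smul" for x f
    using assms(1) that by (intro lp_norm_mono) (auto intro: state_pairs_norm_le)
  then have "bdd_above ((\<lambda>(x, f). lp_norm p k (\<lambda>i. norm (blinfun_apply f (blinfun_apply (T i) x))))
      ` state_pairs smul)"
    by (intro bdd_aboveI2[where M = "lp_norm p k (\<lambda>i. norm (T i))"]) auto
  from cSUP_upper[OF assms(2) this] show ?thesis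
    by (simp add: joint_numerical_radius_def lp_norm_def)
qed

lemma joint_numerical_radius_nonneg:
  assumes "0 < p" "state_pairs smul \<noteq> {}"
  shows "0 \<le> joint_numerical_radius smul p k T"
proof -
  obtain x f where "(x, f) \<in> state_pairs smul"
    using assms by (metis ex_in_conv surj_pair)
  from joint_numerical_radius_upper[OF assms(1) this, of k T] show ?thesis
    using lp_norm_nonneg order_trans by blast
qed

text \<open>At each state pair the p-norm dominates every single entry.\<close>

lemma numerical_radius_component_le:
  assumes "0 < p" "i \<in> {1..k}" "state_pairs smul \<noteq> {}"
  shows "numerical_radius smul (T i) \<le> joint_numerical_radius smul p k T"
proof (rule numerical_radius_least[OF assms(3)])
  fix x f assume xf: "(x, f) \<in> state_pairs smul"
  have "norm (blinfun_apply f (blinfun_apply (T i) x))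
      \<le> lp_norm p k (\<lambda>i. norm (blinfun_apply f (blinfun_apply (T i) x)))"
    using assms by (intro component_le_lp_norm) auto
  also have "\<dots> \<le> joint_numerical_radius smul p k T"
    using assms(1) xf by (rule joint_numerical_radius_upper)
  finally show "norm (blinfun_apply f (blinfun_apply (T i) x)) \<le> joint_numerical_radius smul p k T" .
qed

text \<open>Padding by zeros leaves one entry at every point, so each supremum is taken over the
  same values as for \<open>T\<close>. The restriction makes \<open>U\<close> extensional, as
  membership in the index set of \<open>joint_numerical_index\<close> demands.\<close>

lemma
  fixes T :: "'a::real_normed_vector \<Rightarrow>\<^sub>L 'a"
  assumes "0 < p" "1 \<le> k"
  defines "U \<equiv> \<lambda>i\<in>{1..k}. if i = 1 then T else 0"
  shows joint_norm_single: "(\<exists>x::'a. x \<noteq> 0) \<Longrightarrow> joint_norm p k U = norm T"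
    and joint_numerical_radius_single:
      "joint_numerical_radius smul p k U = numerical_radius smul T"
proof -
  have 1: "lp_norm p k (\<lambda>i. norm (blinfun_apply (U i) x)) = norm (blinfun_apply T x)" for x
    using assms by (subst lp_norm_single) (auto simp: U_def)
  have 2: "lp_norm p k (\<lambda>i. norm (blinfun_apply f (blinfun_apply (U i) x)))
      = norm (blinfun_apply f (blinfun_apply T x))" for x and f :: "'a \<Rightarrow>\<^sub>L 'b"
    using assms by (subst lp_norm_single) (auto simp: U_def)
  show "joint_norm p k U = norm T" if "\<exists>x::'a. x \<noteq> 0"
    using SUP_norm_sphere[OF that, of T] by (simp only: joint_norm_def 1[unfolded lp_norm_def])
  show "joint_numerical_radius smul p k U = numerical_radius smul T"
    by (simp only: joint_numerical_radius_def numerical_radius_def 2[unfolded lp_norm_def])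
qed

section \<open>Comparison of the indices\<close>

context normed_space_over
begin

lemma zero_in_bounded_operators: "0 \<in> bounded_operators smul"
  by (auto simp: bounded_operators_def intro!: linear_smulI)

lemma id_in_bounded_operators: "id_blinfun \<in> bounded_operators smul"
  by (auto simp: bounded_operators_def intro!: linear_smulI)

lemma scaleR_in_bounded_operators:
  assumes "T \<in> bounded_operators smul"
  shows "r *\<^sub>R T \<in> bounded_operators smul"
proof -
  interpret T: Vector_Spaces.linear smul smul "blinfun_apply T"
    using assms by (simp add: bounded_operators_def)
  \<comment> \<open>Real scaling is \<open>smul (of_real r)\<close>, and multiplication in the
    scalar field commutes.\<close>
  have "r *\<^sub>R smul c y = smul c (r *\<^sub>R y)" for c y
    by (simp add: mult.commute flip: smul_of_real)
  then show ?thesis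
    by (auto simp: bounded_operators_def blinfun.scaleR_left T.add T.scale scaleR_right_distrib
        intro!: linear_smulI)
qed

section \<open>Both inequalities, uniformly in the scalar field, once state pairs exist\<close>

context
  assumes states: "state_pairs smul \<noteq> {}" and nonzero: "\<exists>x::'a. x \<noteq> 0"
begin

lemma numerical_index_nonneg: "0 \<le> numerical_index smul"
  unfolding numerical_index_def
  using numerical_radius_nonneg[OF states] id_in_bounded_operators norm_id_blinfun[OF nonzero]
  by (intro cINF_greatest) auto

text \<open>A nonzero operator is normalised to norm one; for \<open>T = 0\<close> the left side
  vanishes.\<close>

lemma numerical_index_le:
  assumes "T \<in> bounded_operators smul"
  shows "numerical_index smul * norm T \<le> numerical_radius smul T"
proof (cases "T = 0")
  case True
  with numerical_radius_nonneg[OF states] show ?thesis by simp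
next
  case False
  have "numerical_index smul \<le> numerical_radius smul (inverse (norm T) *\<^sub>R T)"
    unfolding numerical_index_def
  proof (rule cINF_lower)
    show "bdd_below (numerical_radius smul ` {T \<in> bounded_operators smul. norm T = 1})"
      by (rule bdd_belowI2) (rule numerical_radius_nonneg[OF states])
  qed (use False assms in \<open>auto intro: scaleR_in_bounded_operators\<close>)
  also have "\<dots> \<le> \<bar>inverse (norm T)\<bar> * numerical_radius smul T"
    by (rule numerical_radius_scaleR_le[OF states])
  finally show ?thesis
    using False by (simp add: field_simps)
qed

lemma joint_numerical_radius_ge:
  assumes "0 < p" "T \<in> {1..k} \<rightarrow>\<^sub>E bounded_operators smul"
  shows "numerical_index smul * joint_norm p k T
    \<le> real k powr (1 / p) * joint_numerical_radius smul p k T"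
proof -
  let ?n = "numerical_index smul" and ?W = "joint_numerical_radius smul p k T"
  have "?n * joint_norm p k T \<le> ?n * lp_norm p k (\<lambda>i. norm (T i))"
    using numerical_index_nonneg joint_norm_le[OF assms(1) nonzero] by (intro mult_left_mono)
  also have "\<dots> = lp_norm p k (\<lambda>i. ?n * norm (T i))"
    using assms numerical_index_nonneg by (simp add: lp_norm_scale)
  \<comment> \<open>All entries are bounded by the same number, and the constant vector costs the
    factor in \<open>k\<close>.\<close>
  also have "\<dots> \<le> lp_norm p k (\<lambda>i. ?W)"
  proof (rule lp_norm_mono[OF assms(1)])
    fix i assume i: "i \<in> {1..k}"
    then show "?n * norm (T i) \<le> ?W"
      using numerical_index_le[of "T i"] numerical_radius_component_le[OF assms(1) i states, of T]
        assms(2) by (meson PiE_mem order_trans)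
  qed (simp add: numerical_index_nonneg)
  also have "\<dots> = real k powr (1 / p) * ?W"
    using assms(1) joint_numerical_radius_nonneg[OF assms(1) states] by (rule lp_norm_const)
  finally show ?thesis .
qed

lemma joint_numerical_index_le_radius:
  assumes "0 < p" "1 \<le> k" "T \<in> bounded_operators smul" "norm T = 1"
  shows "joint_numerical_index smul p k \<le> numerical_radius smul T"
proof -
  \<comment> \<open>The zero-padded tuple competes in the joint infimum with the radius of
    \<open>T\<close>.\<close>
  let ?U = "\<lambda>i\<in>{1..k}. if i = 1 then T else 0"
  have "joint_norm p k ?U = 1"
    using joint_norm_single[OF assms(1,2) nonzero] assms(4) by simp
  with assms(3) have "?U \<in> {T \<in> {1..k} \<rightarrow>\<^sub>E bounded_operators smul. joint_norm p k T = 1}"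
    by (auto simp: zero_in_bounded_operators restrict_PiE_iff)
  moreover have "bdd_below (joint_numerical_radius smul p k
      ` {T \<in> {1..k} \<rightarrow>\<^sub>E bounded_operators smul. joint_norm p k T = 1})"
    by (rule bdd_belowI2) (rule joint_numerical_radius_nonneg[OF assms(1) states])
  ultimately have "joint_numerical_index smul p k \<le> joint_numerical_radius smul p k ?U"
    unfolding joint_numerical_index_def by (intro cINF_lower)
  then show ?thesis
    by (simp only: joint_numerical_radius_single[OF assms(1,2)])
qed

lemma joint_numerical_index_upper:
  assumes "0 < p" "1 \<le> k"
  shows "joint_numerical_index smul p k \<le> numerical_index smul"
  unfolding numerical_index_def
  using joint_numerical_index_le_radius[OF assms] id_in_bounded_operators norm_id_blinfun[OF nonzero]
  by (intro cINF_greatest) auto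

lemma joint_numerical_index_lower:
  assumes "0 < p" "1 \<le> k"
  shows "numerical_index smul / real k powr (1 / p) \<le> joint_numerical_index smul p k"
  unfolding joint_numerical_index_def
proof (rule cINF_greatest)
  \<comment> \<open>A witness that the joint infimum is not taken over the empty set.\<close>
  let ?U = "\<lambda>i\<in>{1..k}. if i = 1 then id_blinfun else 0 :: 'a \<Rightarrow>\<^sub>L 'a"
  have "joint_norm p k ?U = 1"
    using joint_norm_single[OF assms nonzero] norm_id_blinfun[OF nonzero] by simp
  then have "?U \<in> {T \<in> {1..k} \<rightarrow>\<^sub>E bounded_operators smul. joint_norm p k T = 1}"
    by (auto simp: zero_in_bounded_operators id_in_bounded_operators restrict_PiE_iff)
  then show "{T \<in> {1..k} \<rightarrow>\<^sub>E bounded_operators smul. joint_norm p k T = 1} \<noteq> {}"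
    by blast
next
  fix T assume T: "T \<in> {T \<in> {1..k} \<rightarrow>\<^sub>E bounded_operators smul. joint_norm p k T = 1}"
  then have "numerical_index smul \<le> real k powr (1 / p) * joint_numerical_radius smul p k T"
    using joint_numerical_radius_ge[OF assms(1), of T k] by simp
  \<comment> \<open>Since \<open>k\<close> is at least one, the factor is positive and may be
    divided out.\<close>
  with assms show "numerical_index smul / real k powr (1 / p) \<le> joint_numerical_radius smul p k T"
    by (simp add: field_simps)
qed

end

end

theorem theorem3p1:
  fixes p :: real and k :: nat
  assumes "1 \<le> p" and "1 \<le> k"
  shows
    "((\<exists>x::'r::banach. x \<noteq> 0) \<longrightarrow>
        numerical_index (scaleR :: real \<Rightarrow> 'r \<Rightarrow> 'r) / real k powr (1 / p)
          \<le> joint_numerical_index (scaleR :: real \<Rightarrow> 'r \<Rightarrow> 'r) p k \<and>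
        joint_numerical_index (scaleR :: real \<Rightarrow> 'r \<Rightarrow> 'r) p k
          \<le> numerical_index (scaleR :: real \<Rightarrow> 'r \<Rightarrow> 'r)) \<and>
     (\<forall>scaleC :: complex \<Rightarrow> 'c::banach \<Rightarrow> 'c.
        normed_space_over scaleC \<longrightarrow> (\<exists>x::'c. x \<noteq> 0) \<longrightarrow>
          numerical_index scaleC / real k powr (1 / p) \<le> joint_numerical_index scaleC p k \<and>
          joint_numerical_index scaleC p k \<le> numerical_index scaleC)"
proof (intro conjI impI allI)
  have p: "0 < p" using assms by simp
  \<comment> \<open>The open slots are the locale predicate, a state pair and a nonzero vector,
    filled once for each scalar field.\<close>
  note bounds = normed_space_over.joint_numerical_index_lower[OF _ _ _ p assms(2)]
    normed_space_over.joint_numerical_index_upper[OF _ _ _ p assms(2)]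
  {
    assume nz: "\<exists>x::'r. x \<noteq> 0"
    note real = bounds[OF normed_space_over_scaleR state_pairs_scaleR_nonempty[OF nz] nz]
    show "numerical_index (scaleR :: real \<Rightarrow> 'r \<Rightarrow> 'r) / real k powr (1 / p)
        \<le> joint_numerical_index (scaleR :: real \<Rightarrow> 'r \<Rightarrow> 'r) p k"
      and "joint_numerical_index (scaleR :: real \<Rightarrow> 'r \<Rightarrow> 'r) p k
        \<le> numerical_index (scaleR :: real \<Rightarrow> 'r \<Rightarrow> 'r)"
      by (fact real)+
  next
    fix scaleC :: "complex \<Rightarrow> 'c \<Rightarrow> 'c"
    assume ns: "normed_space_over scaleC" and nz: "\<exists>x::'c. x \<noteq> 0"
    note complex = bounds[OF ns state_pairs_complex_nonempty[OF ns nz] nz]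
    show "numerical_index scaleC / real k powr (1 / p) \<le> joint_numerical_index scaleC p k"
      and "joint_numerical_index scaleC p k \<le> numerical_index scaleC"
      by (fact complex)+
  }
qed

end
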